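(* (a) If $X$ and $Y$ are independent real random variables with log-concave densities $p$ and $q$ on $\mathbb{R}$ respectively, then $X+Y$, which has density $p\star q$, is also log-concave (that is, $p\star q$ is a log-concave density). (b) Let $\sigma^2>0$ and $\tau^2>0$. If $X\in SLC_1(\sigma^2,1)$ and $Y\in SLC_1(\tau^2,1)$ are independent, then $X+Y\in SLC_1(\sigma^2+\tau^2,1)$.
   Context: A nonnegative function $f$ on $\mathbb{R}$ is log-concave if $f=e^{-\varphi}$ with $\varphi:\mathbb{R}\to(-\infty,\infty]$ convex. $p\star q(z)=\int_{\mathbb{R}}p(x)q(z-x)\,dx$ denotes convolution. For $\sigma^2>0$, $SLC_1(\sigma^2,1)$ (strongly log-concave densities with variance parameter $\sigma^2$ on $\mathbb{R}$) is the class of probability densities of the form $p(x)=g(x)\phi_{\sigma^2}(x)$, where $g$ is a log-concave function and $\phi_{\sigma^2}(x)=(2\pi\sigma^2)^{-1/2}e^{-x^2/(2\sigma^2)}$ is the $N(0,\sigma^2)$ density. A random variable is said to belong to $SLC_1(\sigma^2,1)$ if it has a density in this class. The function $g$ is not required to be integrable. *)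

theory Defs
  imports "HOL-Probability.Probability"
begin

text \<open>Library convexity (\<open>convex_on\<close>) is for real-valued functions only; here the potential
  takes values in \<open>(-\<infinity>, \<infinity>]\<close>.  In \<^typ>\<open>ereal\<close> we have \<open>0 * \<infinity> = 0\<close>, so the endpoints
  \<open>t = 0\<close> and \<open>t = 1\<close> impose nothing, and no \<open>\<infinity> - \<infinity>\<close> arises.\<close>

definition convex_ext :: "(real \<Rightarrow> ereal) \<Rightarrow> bool" where
  "convex_ext \<phi> \<longleftrightarrow>
     (\<forall>x. \<phi> x \<noteq> - \<infinity>) \<and>
     (\<forall>x y. \<forall>t\<in>{0..1}. \<phi> ((1 - t) * x + t * y) \<le> ereal (1 - t) * \<phi> x + ereal t * \<phi> y)"

text \<open>\<open>exp (- a)\<close> for \<open>a \<in> (-\<infinity>, \<infinity>]\<close>; the value at \<open>- \<infinity>\<close> is junk and never used.\<close>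

definition exp_minus_ext :: "ereal \<Rightarrow> real" where
  "exp_minus_ext a = (if a = \<infinity> then 0 else exp (- real_of_ereal a))"

definition log_concave :: "(real \<Rightarrow> real) \<Rightarrow> bool" where
  "log_concave f \<longleftrightarrow> (\<exists>\<phi>. convex_ext \<phi> \<and> (\<forall>x. f x = exp_minus_ext (\<phi> x)))"

definition prob_density :: "(real \<Rightarrow> real) \<Rightarrow> bool" where
  "prob_density p \<longleftrightarrow>
     p \<in> borel_measurable borel \<and> (\<forall>x. 0 \<le> p x) \<and> (\<integral>\<^sup>+x. ennreal (p x) \<partial>lborel) = 1"

definition log_concave_density :: "(real \<Rightarrow> real) \<Rightarrow> bool" where
  "log_concave_density p \<longleftrightarrow> prob_density p \<and> log_concave p"

text \<open>Convolution of functions; the library's \<open>convolution\<close> acts on measures.\<close>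

definition fun_convolution :: "(real \<Rightarrow> real) \<Rightarrow> (real \<Rightarrow> real) \<Rightarrow> real \<Rightarrow> real" where
  "fun_convolution p q z = (LINT x|lborel. p x * q (z - x))"

text \<open>The parameter \<open>v\<close> is the variance, whereas the library's \<^const>\<open>normal_density\<close> takes the
  standard deviation.\<close>

definition SLC1 :: "real \<Rightarrow> (real \<Rightarrow> real) set" where
  "SLC1 v = {p. prob_density p \<and>
                (\<exists>g. log_concave g \<and> (\<forall>x. p x = g x * normal_density 0 (sqrt v) x))}"

definition rv_SLC1 :: "'a measure \<Rightarrow> ('a \<Rightarrow> real) \<Rightarrow> real \<Rightarrow> bool" where
  "rv_SLC1 M X v \<longleftrightarrow> (\<exists>p\<in>SLC1 v. distributed M lborel X (\<lambda>x. ennreal (p x)))"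

end

theory Submission
  imports Defs
begin

text \<open>
  Convolving two densities means integrating the kernel \<open>p x * q (z - x)\<close> over one of its
  two variables.  The kernel is log-concave jointly in \<open>(x, z)\<close>, because \<open>x\<close> and \<open>z - x\<close> are linear
  in \<open>(x, z)\<close>, and integrating out a variable preserves log-concavity (\<open>log_concave_marginal\<close>).
  The latter is the one-dimensional Prekopa-Leindler inequality (\<open>prekopa_leindler_real\<close>), applied
  to the fibres of the kernel over \<open>z\<close>, over \<open>w\<close> and over \<open>(1 - t) * z + t * w\<close>.

  Prekopa-Leindler follows from the Brunn-Minkowski inequality on the line
  (\<open>brunn_minkowski_real\<close>): rescale both functions to have supremum \<open>1\<close>, apply Brunn-Minkowski to
  their superlevel sets, which are then nonempty at the same levels, integrate over the levels and
  finish with the weighted inequality of arithmetic and geometric means.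

  Log-concave densities are bounded (\<open>log_concave_integrable_bdd_above\<close>).  Hence every
  convolution integral is finite at every point \<open>z\<close>, so that the real-valued convolution is an
  honest integral everywhere, and every nonzero fibre of the kernel can be rescaled to have supremum \<open>1\<close>.

  For strongly log-concave densities \<open>p = g \<phi>\<^sub>a\<close> and \<open>q = h \<phi>\<^sub>b\<close>, with \<open>\<phi>\<^sub>v\<close> the centred normal density
  of variance \<open>v\<close>, completing the square gives
  \<open>\<phi>\<^sub>a(x) \<phi>\<^sub>b(z - x) = \<phi>\<^sub>a\<^sub>+\<^sub>b(z) \<psi>(x - a z / (a + b))\<close>, where \<open>\<psi>\<close> is the centred normal density of variance
  \<open>a b / (a + b)\<close>.  The first factor leaves the integral, and what stays
  inside, \<open>g(x) h(z - x) \<psi>(x - a z / (a + b))\<close>, is again jointly log-concave.  Its marginal is the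
  log-concave factor of \<open>p \<star> q\<close> relative to \<open>\<phi>\<^sub>a\<^sub>+\<^sub>b\<close>.
\<close>

section \<open>The Brunn-Minkowski inequality on the line\<close>

text \<open>Exhausting a set by its parts below one of its own points, as opposed to below arbitrary reals,
  is what allows a translate of another set to be attached at that point.\<close>

lemma cofinal_sequence_in_set:
  fixes A :: "real set"
  assumes "A \<noteq> {}"
  shows "\<exists>a::nat \<Rightarrow> real. incseq a \<and> range a \<subseteq> A \<and> A = (\<Union>i. A \<inter> {..a i})"
proof (cases "\<exists>m\<in>A. \<forall>x\<in>A. x \<le> m")
  case True
  then obtain m where "m \<in> A" "\<forall>x\<in>A. x \<le> m" by blast
  then show ?thesis by (intro exI[of _ "\<lambda>_. m"]) (auto simp: incseq_def)
next
  case False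
  obtain f :: "nat \<Rightarrow> ereal" where f: "incseq f" "range f \<subseteq> ereal ` A" "Sup (ereal ` A) = (SUP i. f i)"
    using Sup_countable_SUP[of "ereal ` A"] assms by auto
  define a where "a i = real_of_ereal (f i)" for i
  have fa: "f i = ereal (a i)" "a i \<in> A" for i
    using f(2) unfolding a_def by (auto dest!: range_subsetD[where i=i])
  have "incseq a" using f(1) unfolding incseq_def fa(1) by simp
  moreover have "\<exists>i. x \<le> a i" if "x \<in> A" for x
  proof -
    obtain y where "y \<in> A" "x < y" using False \<open>x \<in> A\<close> by force
    then have "ereal x < (SUP i. f i)"
      unfolding f(3)[symmetric] by (auto simp: less_Sup_iff)
    then show ?thesis
      by (auto simp: less_SUP_iff fa(1) intro: less_imp_le)
  qed
  ultimately show ?thesis using fa(2) by (intro exI[of _ a]) blast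
qed

lemma coinitial_sequence_in_set:
  fixes B :: "real set"
  assumes "B \<noteq> {}"
  shows "\<exists>b::nat \<Rightarrow> real. decseq b \<and> range b \<subseteq> B \<and> B = (\<Union>i. B \<inter> {b i..})"
proof -
  obtain a :: "nat \<Rightarrow> real" where a: "incseq a" "range a \<subseteq> uminus ` B"
      "uminus ` B = (\<Union>i. uminus ` B \<inter> {..a i})"
    using cofinal_sequence_in_set[of "uminus ` B"] assms by auto
  have "- a i \<in> B" for i using range_subsetD[OF a(2), of i] by auto
  moreover have "\<exists>i. - a i \<le> x" if "x \<in> B" for x
  proof -
    have "- x \<in> uminus ` B" using that by simp
    then obtain i where "- x \<le> a i" by (subst (asm) a(3)) blast
    then show ?thesis by (intro exI[of _ i]) simp
  qed
  ultimately show ?thesis using a(1)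
    by (intro exI[of _ "\<lambda>i. - a i"]) (auto simp: incseq_def decseq_def)
qed

lemma emeasure_scaled_translate_le:
  fixes A C :: "real set"
  assumes [measurable]: "A \<in> sets borel" "C \<in> sets borel" and "0 < c"
    and sub: "\<And>x. x \<in> A \<Longrightarrow> d + c * x \<in> C"
  shows "ennreal c * emeasure lborel A \<le> emeasure lborel C"
proof -
  have "emeasure lborel C = \<bar>c\<bar> * (\<integral>\<^sup>+x. indicator C (d + c * x) \<partial>lborel)"
    using \<open>0 < c\<close> by (subst nn_integral_real_affine[symmetric]) auto
  also have "\<dots> \<ge> ennreal c * (\<integral>\<^sup>+x. indicator A x \<partial>lborel)"
    using \<open>0 < c\<close> sub by (intro mult_mono nn_integral_mono) (auto simp: indicator_def)
  finally show ?thesis by simp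
qed

text \<open>Fix \<open>a \<in> A\<close> and \<open>b \<in> B\<close>.  The copy of \<open>A \<inter> {..a}\<close> formed with the single point \<open>b\<close> lies in \<open>C\<close> to the
  left of \<open>m = (1 - t) * a + t * b\<close>, and the copy of \<open>B \<inter> {b..}\<close> formed with the single point \<open>a\<close> lies in
  \<open>C\<close> to the right of \<open>m\<close>.  They share at most the null set \<open>{m}\<close>, so their measures add up.  Now let \<open>a\<close>
  run up through \<open>A\<close> and \<open>b\<close> run down through \<open>B\<close>.\<close>

theorem brunn_minkowski_real:
  fixes A B C :: "real set"
  assumes [measurable]: "A \<in> sets borel" "B \<in> sets borel" "C \<in> sets borel"
    and ne: "A \<noteq> {}" "B \<noteq> {}" and t: "0 < t" "t < 1"
    and sub: "\<And>x y. x \<in> A \<Longrightarrow> y \<in> B \<Longrightarrow> (1 - t) * x + t * y \<in> C"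
  shows "ennreal (1 - t) * emeasure lborel A + ennreal t * emeasure lborel B \<le> emeasure lborel C"
proof -
  have tails: "ennreal (1 - t) * emeasure lborel (A \<inter> {..a}) + ennreal t * emeasure lborel (B \<inter> {b..})
      \<le> emeasure lborel C" if "a \<in> A" "b \<in> B" for a b
  proof -
    define m where "m = (1 - t) * a + t * b"
    have "ennreal (1 - t) * emeasure lborel (A \<inter> {..a}) \<le> emeasure lborel (C \<inter> {..m})"
      using t that sub by (intro emeasure_scaled_translate_le[where d="t * b"])
        (auto simp: m_def add.commute)
    moreover have "ennreal t * emeasure lborel (B \<inter> {b..}) \<le> emeasure lborel (C \<inter> {m..})"
      using t that sub by (intro emeasure_scaled_translate_le[where d="(1 - t) * a"])
        (auto simp: m_def)
    moreover have "emeasure lborel (C \<inter> {m..}) = emeasure lborel (C \<inter> {m<..})"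
      by (rule emeasure_eq_AE) (use AE_lborel_singleton[of m] in \<open>auto elim!: eventually_mono\<close>)
    moreover have "emeasure lborel (C \<inter> {..m}) + emeasure lborel (C \<inter> {m<..}) = emeasure lborel C"
      by (subst plus_emeasure) (auto intro!: arg_cong[where f="emeasure lborel"])
    ultimately show ?thesis by (metis add_mono)
  qed
  obtain a :: "nat \<Rightarrow> real" where a: "incseq a" "range a \<subseteq> A" "A = (\<Union>i. A \<inter> {..a i})"
    using cofinal_sequence_in_set[OF ne(1)] by blast
  obtain b :: "nat \<Rightarrow> real" where b: "decseq b" "range b \<subseteq> B" "B = (\<Union>i. B \<inter> {b i..})"
    using coinitial_sequence_in_set[OF ne(2)] by blast
  have "(\<lambda>i. emeasure lborel (A \<inter> {..a i})) \<longlonglongrightarrow> emeasure lborel (\<Union>i. A \<inter> {..a i})"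
    using a(1) by (intro Lim_emeasure_incseq) (auto simp: incseq_def intro: order_trans)
  moreover have "(\<lambda>i. emeasure lborel (B \<inter> {b i..})) \<longlonglongrightarrow> emeasure lborel (\<Union>i. B \<inter> {b i..})"
    using b(1) by (intro Lim_emeasure_incseq) (auto simp: incseq_def decseq_def intro: order_trans)
  ultimately have "(\<lambda>i. ennreal (1 - t) * emeasure lborel (A \<inter> {..a i}) + ennreal t * emeasure lborel (B \<inter> {b i..}))
      \<longlonglongrightarrow> ennreal (1 - t) * emeasure lborel A + ennreal t * emeasure lborel B"
    unfolding a(3)[symmetric] b(3)[symmetric]
    by (intro tendsto_add ennreal_tendsto_cmult) auto
  then show ?thesis
    by (rule LIMSEQ_le_const2) (use a(2) b(2) tails in blast)
qed

section \<open>The Prekopa-Leindler inequality on the line\<close>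

lemma nn_integral_layer_cake:
  fixes f :: "real \<Rightarrow> real"
  assumes [measurable]: "f \<in> borel_measurable borel" and nonneg: "\<And>x. 0 \<le> f x"
  shows "(\<integral>\<^sup>+x. ennreal (f x) \<partial>lborel) = (\<integral>\<^sup>+l. indicator {0<..} l * emeasure lborel {x. l < f x} \<partial>lborel)"
proof -
  have "(\<integral>\<^sup>+x. ennreal (f x) \<partial>lborel)
      = (\<integral>\<^sup>+x. (\<integral>\<^sup>+l. indicator {0<..} l * indicator {x. l < f x} x \<partial>lborel) \<partial>lborel)"
  proof (intro nn_integral_cong)
    fix x
    have "ennreal (f x) = (\<integral>\<^sup>+l. indicator {0<..<f x} l \<partial>lborel)"
      using nonneg[of x] by simp
    also have "\<dots> = (\<integral>\<^sup>+l. indicator {0<..} l * indicator {x. l < f x} x \<partial>lborel)"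
      by (intro nn_integral_cong) (auto simp: indicator_def)
    finally show "ennreal (f x) = \<dots>" .
  qed
  also have "\<dots> = (\<integral>\<^sup>+l. (\<integral>\<^sup>+x. indicator {0<..} l * indicator {x. l < f x} x \<partial>lborel) \<partial>lborel)"
  proof (rule lborel_pair.Fubini')
    show "(\<lambda>(l, x). indicator {0<..} l * indicator {x. l < f x} x :: ennreal)
        \<in> borel_measurable (lborel \<Otimes>\<^sub>M lborel)"
      unfolding split_beta' indicator_def mem_Collect_eq by measurable
  qed
  also have "\<dots> = (\<integral>\<^sup>+l. indicator {0<..} l * emeasure lborel {x. l < f x} \<partial>lborel)"
    by (intro nn_integral_cong) (auto simp: nn_integral_cmult indicator_def[of "{0<..}"])
  finally show ?thesis .
qed

text \<open>Brunn-Minkowski applies to superlevel sets only when both are nonempty.  Dividing \<open>f\<close> and \<open>g\<close> by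
  their suprema makes this happen at exactly the levels below \<open>1\<close>, up to which both integrals
  are built up; this is where boundedness enters.  The resulting inequality for the rescaled functions
  has an arithmetic mean of the two integrals on the left, which is stronger than the geometric mean,
  and the geometric form is the one that scales back.\<close>

theorem prekopa_leindler_real:
  fixes f g h :: "real \<Rightarrow> real"
  assumes int: "integrable lborel f" "integrable lborel g" "integrable lborel h"
    and nonneg: "\<And>x. 0 \<le> f x" "\<And>x. 0 \<le> g x" "\<And>x. 0 \<le> h x"
    and bdd: "bdd_above (range f)" "bdd_above (range g)"
    and t: "0 < t" "t < 1"
    and le: "\<And>x y. f x powr (1 - t) * g y powr t \<le> h ((1 - t) * x + t * y)"
  shows "(LINT x|lborel. f x) powr (1 - t) * (LINT x|lborel. g x) powr t \<le> (LINT x|lborel. h x)"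
proof (cases "(LINT x|lborel. f x) = 0 \<or> (LINT x|lborel. g x) = 0")
  case True
  then show ?thesis using nonneg(3) by auto
next
  case False
  have [measurable]: "f \<in> borel_measurable borel" "g \<in> borel_measurable borel" "h \<in> borel_measurable borel"
    using int[THEN borel_measurable_integrable] by simp_all
  define a b where "a = Sup (range f)" and "b = Sup (range g)"
  have fa: "f x \<le> a" and gb: "g x \<le> b" for x
    unfolding a_def b_def using bdd by (auto intro: cSup_upper)
  have If: "0 < (LINT x|lborel. f x)" and Ig: "0 < (LINT x|lborel. g x)"
    using False nonneg by (auto simp: less_le)
  have "\<exists>x. f x \<noteq> 0" "\<exists>x. g x \<noteq> 0"
    using False integral_zero[of lborel, where 'a = real] by (metis ext)+
  then have pos: "0 < a" "0 < b"
    using fa gb nonneg by (metis less_le_trans order.not_eq_order_implies_strict)+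
  define c where "c = a powr (1 - t) * b powr t"
  have "0 < c" using pos by (simp add: c_def)
  define F G H where "F x = f x / a" and "G x = g x / b" and "H x = h x / c" for x
  have [measurable]: "F \<in> borel_measurable borel" "G \<in> borel_measurable borel" "H \<in> borel_measurable borel"
    unfolding F_def G_def H_def by measurable
  have FGH0: "0 \<le> F x" "0 \<le> G x" "0 \<le> H x" for x
    using nonneg pos \<open>0 < c\<close> by (simp_all add: F_def G_def H_def)
  have FG1: "F x \<le> 1" "G x \<le> 1" for x
    using fa gb pos by (simp_all add: F_def G_def)
  have FGH: "F x powr (1 - t) * G y powr t \<le> H ((1 - t) * x + t * y)" for x y
    using le[of x y] \<open>0 < c\<close> nonneg pos
    by (simp add: F_def G_def H_def c_def powr_divide divide_right_mono)
  have level: "ennreal (1 - t) * emeasure lborel {x. l < F x} + ennreal t * emeasure lborel {x. l < G x}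
      \<le> emeasure lborel {x. l < H x}" if "0 < l" for l
  proof (cases "l < 1")
    case True
    have "\<exists>x. l * a < f x" "\<exists>x. l * b < g x"
      using True pos less_cSup_iff[OF _ bdd(1), of "l * a"] less_cSup_iff[OF _ bdd(2), of "l * b"]
      by (auto simp: a_def b_def)
    then have ne: "{x. l < F x} \<noteq> {}" "{x. l < G x} \<noteq> {}"
      using pos by (auto simp: F_def G_def field_simps)
    show ?thesis
    proof (rule brunn_minkowski_real[OF _ _ _ ne t])
      fix x y assume xy: "x \<in> {x. l < F x}" "y \<in> {x. l < G x}"
      have "l = l powr (1 - t) * l powr t"
        using \<open>0 < l\<close> by (simp flip: powr_add)
      also have "\<dots> < F x powr (1 - t) * G y powr t"
        using xy \<open>0 < l\<close> t by (intro mult_strict_mono powr_less_mono2) auto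
      also note FGH
      finally show "(1 - t) * x + t * y \<in> {x. l < H x}" by simp
    qed measurable
  next
    case False
    then have "{x. l < F x} = {}" "{x. l < G x} = {}"
      using FG1 by (auto simp: not_less intro: order_trans)
    then show ?thesis by simp
  qed
  have intFGH: "integrable lborel F" "integrable lborel G" "integrable lborel H"
    unfolding F_def G_def H_def by (intro integrable_divide_zero int)+
  have "ennreal ((1 - t) * (LINT x|lborel. F x) + t * (LINT x|lborel. G x))
      = ennreal (1 - t) * (\<integral>\<^sup>+x. F x \<partial>lborel) + ennreal t * (\<integral>\<^sup>+x. G x \<partial>lborel)"
    using t intFGH FGH0 by (simp add: nn_integral_eq_integral ennreal_plus ennreal_mult)
  also have "\<dots> = (\<integral>\<^sup>+l. indicator {0<..} l * (ennreal (1 - t) * emeasure lborel {x. l < F x}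
      + ennreal t * emeasure lborel {x. l < G x}) \<partial>lborel)"
    by (subst (1 2) nn_integral_layer_cake)
      (auto simp: FGH0 nn_integral_add nn_integral_cmult distrib_left mult.left_commute)
  also have "\<dots> \<le> (\<integral>\<^sup>+l. indicator {0<..} l * emeasure lborel {x. l < H x} \<partial>lborel)"
    using level by (intro nn_integral_mono) (auto simp: indicator_def)
  also have "\<dots> = (\<integral>\<^sup>+x. H x \<partial>lborel)"
    by (rule nn_integral_layer_cake[symmetric]) (auto simp: FGH0)
  also have "\<dots> = ennreal (LINT x|lborel. H x)"
    using intFGH FGH0 by (simp add: nn_integral_eq_integral)
  finally have "(1 - t) * (LINT x|lborel. F x) + t * (LINT x|lborel. G x) \<le> (LINT x|lborel. H x)"
    using FGH0 by (subst (asm) ennreal_le_iff) auto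
  moreover have "(LINT x|lborel. F x) powr (1 - t) * (LINT x|lborel. G x) powr t
      \<le> (1 - t) * (LINT x|lborel. F x) + t * (LINT x|lborel. G x)"
    using t If Ig pos by (intro Youngs_inequality_0) (auto simp: F_def G_def)
  ultimately have "(LINT x|lborel. F x) powr (1 - t) * (LINT x|lborel. G x) powr t \<le> (LINT x|lborel. H x)"
    by linarith
  then show ?thesis
    using If Ig pos \<open>0 < c\<close> by (simp add: F_def G_def H_def powr_divide c_def divide_le_cancel)
qed

section \<open>Log-concave functions\<close>

text \<open>A description of log-concavity without potentials, in which the value \<open>0\<close> of \<open>f\<close> (the value
  \<open>\<infinity>\<close> of the potential) is handled by \<open>0 powr s = 0\<close>.\<close>

lemma log_concave_iff:
  "log_concave f \<longleftrightarrow> (\<forall>x. 0 \<le> f x) \<and>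
     (\<forall>x y t. 0 < t \<longrightarrow> t < 1 \<longrightarrow> f x powr (1 - t) * f y powr t \<le> f ((1 - t) * x + t * y))"
  (is "_ \<longleftrightarrow> ?nonneg \<and> ?ineq")
proof
  assume "log_concave f"
  then obtain \<phi> where \<phi>: "convex_ext \<phi>" and f: "\<And>x. f x = exp_minus_ext (\<phi> x)"
    unfolding log_concave_def by blast
  have "f x powr (1 - t) * f y powr t \<le> f ((1 - t) * x + t * y)" if t: "0 < t" "t < 1" for x y t
  proof (cases "\<phi> x = \<infinity> \<or> \<phi> y = \<infinity>")
    case True
    then show ?thesis by (auto simp: f exp_minus_ext_def)
  next
    case False
    then obtain u v where uv: "\<phi> x = ereal u" "\<phi> y = ereal v"
      using \<phi> by (metis convex_ext_def ereal_cases)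
    have le: "\<phi> ((1 - t) * x + t * y) \<le> ereal ((1 - t) * u + t * v)"
      using \<phi>[unfolded convex_ext_def, THEN conjunct2, rule_format, of t x y] t by (simp add: uv)
    moreover have "\<phi> ((1 - t) * x + t * y) \<noteq> - \<infinity>"
      using \<phi> by (simp add: convex_ext_def)
    ultimately obtain w where w: "\<phi> ((1 - t) * x + t * y) = ereal w" "w \<le> (1 - t) * u + t * v"
      by (cases "\<phi> ((1 - t) * x + t * y)") auto
    then show ?thesis
      by (simp add: f exp_minus_ext_def uv powr_def algebra_simps flip: exp_add)
  qed
  then show "?nonneg \<and> ?ineq"
    by (auto simp: f exp_minus_ext_def)
next
  assume f: "?nonneg \<and> ?ineq"
  define \<phi> where "\<phi> x = (if f x = 0 then \<infinity> else ereal (- ln (f x)))" for x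
  have "\<phi> ((1 - t) * x + t * y) \<le> ereal (1 - t) * \<phi> x + ereal t * \<phi> y" if t: "0 \<le> t" "t \<le> 1" for x y t
  proof (cases "t = 0 \<or> t = 1")
    case True
    then show ?thesis by (auto simp flip: zero_ereal_def one_ereal_def)
  next
    case False
    with t have t: "0 < t" "t < 1" by auto
    show ?thesis
    proof (cases "f x = 0 \<or> f y = 0")
      case True
      then show ?thesis using t by (auto simp: \<phi>_def)
    next
      case False
      with f have pos: "0 < f x" "0 < f y" by (auto simp: less_le)
      have le: "f x powr (1 - t) * f y powr t \<le> f ((1 - t) * x + t * y)"
        using f t by blast
      moreover have "0 < f x powr (1 - t) * f y powr t" using pos by simp
      ultimately have "ln (f x powr (1 - t) * f y powr t) \<le> ln (f ((1 - t) * x + t * y))"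
          "0 < f ((1 - t) * x + t * y)" by simp_all
      then show ?thesis
        using pos by (simp add: \<phi>_def ln_mult ln_powr)
    qed
  qed
  then have "convex_ext \<phi>"
    by (auto simp: convex_ext_def \<phi>_def)
  moreover have "f x = exp_minus_ext (\<phi> x)" for x
    using f by (auto simp: \<phi>_def exp_minus_ext_def less_le)
  ultimately show "log_concave f" unfolding log_concave_def by blast
qed

lemma log_concave_nonneg: "log_concave f \<Longrightarrow> 0 \<le> f x"
  by (simp add: log_concave_iff)

lemma log_concaveD:
  "log_concave f \<Longrightarrow> 0 < t \<Longrightarrow> t < 1 \<Longrightarrow> f x powr (1 - t) * f y powr t \<le> f ((1 - t) * x + t * y)"
  by (simp add: log_concave_iff)

lemma log_concave_mult:
  assumes "log_concave f" "log_concave g"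
  shows "log_concave (\<lambda>x. f x * g x)"
  unfolding log_concave_iff
proof (intro conjI allI impI)
  fix x y t :: real assume t: "0 < t" "t < 1"
  have "(f x * g x) powr (1 - t) * (f y * g y) powr t
      = (f x powr (1 - t) * f y powr t) * (g x powr (1 - t) * g y powr t)"
    by (simp add: powr_mult)
  also have "\<dots> \<le> f ((1 - t) * x + t * y) * g ((1 - t) * x + t * y)"
    using assms t by (intro mult_mono log_concaveD) (auto simp: log_concave_nonneg)
  finally show "(f x * g x) powr (1 - t) * (f y * g y) powr t
      \<le> f ((1 - t) * x + t * y) * g ((1 - t) * x + t * y)" .
qed (simp add: assms log_concave_nonneg)

lemma log_concave_gaussian:
  assumes "0 \<le> C" "0 \<le> k"
  shows "log_concave (\<lambda>x. C * exp (- k * x\<^sup>2))"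
  unfolding log_concave_iff
proof (intro conjI allI impI)
  fix x y t :: real assume t: "0 < t" "t < 1"
  have "(1 - t) * x\<^sup>2 + t * y\<^sup>2 - ((1 - t) * x + t * y)\<^sup>2 = t * (1 - t) * (x - y)\<^sup>2"
    by (simp add: power2_eq_square algebra_simps)
  also have "\<dots> \<ge> 0" using t by simp
  finally have "k * ((1 - t) * x + t * y)\<^sup>2 \<le> k * ((1 - t) * x\<^sup>2 + t * y\<^sup>2)"
    using assms by (intro mult_left_mono) auto
  then have "exp (- k * x\<^sup>2) powr (1 - t) * exp (- k * y\<^sup>2) powr t \<le> exp (- k * ((1 - t) * x + t * y)\<^sup>2)"
    by (simp add: powr_def algebra_simps flip: exp_add)
  moreover have "C powr (1 - t) * C powr t = C"
    using assms by (simp flip: powr_add)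
  moreover have "(C * exp (- k * x\<^sup>2)) powr (1 - t) * (C * exp (- k * y\<^sup>2)) powr t
      = (C powr (1 - t) * C powr t) * (exp (- k * x\<^sup>2) powr (1 - t) * exp (- k * y\<^sup>2) powr t)"
    by (simp add: powr_mult)
  ultimately show "(C * exp (- k * x\<^sup>2)) powr (1 - t) * (C * exp (- k * y\<^sup>2)) powr t
      \<le> C * exp (- k * ((1 - t) * x + t * y)\<^sup>2)"
    using assms by (simp add: mult_left_mono)
qed (use assms in simp)

section \<open>Marginals of jointly log-concave functions\<close>

definition log_concave2 :: "(real \<Rightarrow> real \<Rightarrow> real) \<Rightarrow> bool" where
  "log_concave2 K \<longleftrightarrow> (\<forall>x z. 0 \<le> K x z) \<and>
     (\<forall>x y z w t. 0 < t \<longrightarrow> t < 1 \<longrightarrow>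
        K x z powr (1 - t) * K y w powr t \<le> K ((1 - t) * x + t * y) ((1 - t) * z + t * w))"

lemma log_concave2_linear:
  assumes "log_concave f"
  shows "log_concave2 (\<lambda>x z. f (a * x + b * z))"
  unfolding log_concave2_def
proof (intro conjI allI impI)
  fix x y z w t :: real assume t: "0 < t" "t < 1"
  have "a * ((1 - t) * x + t * y) + b * ((1 - t) * z + t * w)
      = (1 - t) * (a * x + b * z) + t * (a * y + b * w)"
    by (simp add: algebra_simps)
  then show "f (a * x + b * z) powr (1 - t) * f (a * y + b * w) powr t
      \<le> f (a * ((1 - t) * x + t * y) + b * ((1 - t) * z + t * w))"
    using log_concaveD[OF assms t] by simp
qed (simp add: assms log_concave_nonneg)

lemma log_concave2_mult:
  assumes "log_concave2 K" "log_concave2 L"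
  shows "log_concave2 (\<lambda>x z. K x z * L x z)"
  unfolding log_concave2_def
proof (intro conjI allI impI)
  fix x y z w t :: real assume t: "0 < t" "t < 1"
  let ?x = "(1 - t) * x + t * y" and ?z = "(1 - t) * z + t * w"
  have "(K x z * L x z) powr (1 - t) * (K y w * L y w) powr t
      = (K x z powr (1 - t) * K y w powr t) * (L x z powr (1 - t) * L y w powr t)"
    by (simp add: powr_mult)
  also have "\<dots> \<le> K ?x ?z * L ?x ?z"
    using assms t by (intro mult_mono) (auto simp: log_concave2_def)
  finally show "(K x z * L x z) powr (1 - t) * (K y w * L y w) powr t \<le> K ?x ?z * L ?x ?z" .
qed (use assms in \<open>simp add: log_concave2_def\<close>)

lemma log_concave2_convolution_kernel:
  assumes "log_concave p" "log_concave q"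
  shows "log_concave2 (\<lambda>x z. p x * q (z - x))"
  using log_concave2_mult[OF log_concave2_linear[OF assms(1), of 1 0] log_concave2_linear[OF assms(2), of "-1" 1]]
  by simp

text \<open>Joint log-concavity of \<open>K\<close> is precisely the hypothesis of Prekopa-Leindler for the fibres of \<open>K\<close>
  over two points and over a point between them.\<close>

theorem log_concave_marginal:
  assumes K: "log_concave2 K"
    and int: "\<And>z. integrable lborel (\<lambda>x. K x z)"
    and bdd: "\<And>z. bdd_above (range (\<lambda>x. K x z))"
  shows "log_concave (\<lambda>z. LINT x|lborel. K x z)"
  unfolding log_concave_iff
proof (intro conjI allI impI)
  fix z w t :: real assume "0 < t" "t < 1"
  then show "(LINT x|lborel. K x z) powr (1 - t) * (LINT x|lborel. K x w) powr t
      \<le> (LINT x|lborel. K x ((1 - t) * z + t * w))"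
    using K by (intro prekopa_leindler_real int bdd) (auto simp: log_concave2_def)
qed (use K in \<open>auto simp: log_concave2_def\<close>)

section \<open>Boundedness of integrable log-concave functions\<close>

text \<open>A high value \<open>p x\<close> forces a large integral: if \<open>d \<le> p w\<close> and \<open>d \<le> p x\<close>, then on the half of the segment
  from \<open>w\<close> to \<open>x\<close> next to \<open>x\<close> log-concavity keeps \<open>p\<close> above \<open>sqrt (d * p x)\<close>.  To bound \<open>p x\<close> uniformly,
  the segment must not become short, so \<open>w\<close> is taken from two fixed points \<open>u < v\<close> where \<open>p\<close> is positive:
  every \<open>x\<close> has distance at least \<open>(v - u) / 2\<close> from one of them.  If there are no such points, \<open>p\<close>
  vanishes except at one point.\<close>

lemma log_concave_integrable_bdd_above:
  assumes lc: "log_concave p" and int: "integrable lborel p"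
  shows "bdd_above (range p)"
proof (cases "\<exists>u v. u < v \<and> 0 < p u \<and> 0 < p v")
  case False
  then obtain c where "\<And>x. x \<noteq> c \<Longrightarrow> p x = 0"
    using log_concave_nonneg[OF lc] by (metis less_le linorder_neqE)
  then have "p x \<le> max (p c) 0" for x by (cases "x = c") auto
  then show ?thesis by (intro bdd_aboveI2)
next
  case True
  then obtain u v where uv: "u < v" "0 < p u" "0 < p v" by blast
  have [measurable]: "p \<in> borel_measurable borel"
    using int by (auto dest: borel_measurable_integrable)
  define I d where "I = (LINT x|lborel. p x)" and "d = min (p u) (p v)"
  have d: "0 < d" "d \<le> p u" "d \<le> p v" using uv by (auto simp: d_def)
  have key: "\<bar>x - w\<bar> / 2 * sqrt (d * p x) \<le> I" if "d \<le> p w" "d \<le> p x" for x w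
  proof (cases "x = w")
    case True
    then show ?thesis by (simp add: I_def log_concave_nonneg[OF lc])
  next
    case False
    \<comment> \<open>Splitting off the exponent \<open>1/2\<close> of \<open>p x\<close> leaves \<open>d powr (s - 1/2)\<close>, which \<open>d \<le> p x\<close> allows to
      trade for \<open>p x powr (s - 1/2)\<close> as long as \<open>s \<ge> 1/2\<close>.\<close>
    have ptwise: "sqrt (d * p x) \<le> p (w + (x - w) * s)" if s: "1/2 < s" "s < 1" for s
    proof -
      have "sqrt (d * p x) = (d * p x) powr (1/2)"
        using d \<open>d \<le> p x\<close> by (simp add: powr_half_sqrt)
      also have "\<dots> = d powr (1 - s) * d powr (s - 1/2) * p x powr (1/2)"
        by (simp add: powr_mult flip: powr_add)
      also have "\<dots> \<le> d powr (1 - s) * p x powr (s - 1/2) * p x powr (1/2)"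
        using d s \<open>d \<le> p x\<close> by (intro mult_right_mono mult_left_mono powr_mono2) auto
      also have "\<dots> = d powr (1 - s) * p x powr s"
        by (simp add: mult.assoc flip: powr_add)
      also have "\<dots> \<le> p w powr (1 - s) * p x powr s"
        using d s \<open>d \<le> p w\<close> by (intro mult_right_mono powr_mono2) auto
      also have "\<dots> \<le> p ((1 - s) * w + s * x)"
        using s by (intro log_concaveD[OF lc]) auto
      finally show ?thesis by (simp add: algebra_simps)
    qed
    have "ennreal (\<bar>x - w\<bar> / 2 * sqrt (d * p x))
        = ennreal \<bar>x - w\<bar> * (\<integral>\<^sup>+s. ennreal (sqrt (d * p x)) * indicator {1/2<..<1::real} s \<partial>lborel)"
    proof -
      have "emeasure lborel {1/2<..<1::real} = ennreal (1/2)"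
        by (subst emeasure_lborel_Ioo) auto
      moreover have "0 \<le> sqrt (d * p x)"
        using log_concave_nonneg[OF lc] d by simp
      moreover have "\<bar>x - w\<bar> / 2 * sqrt (d * p x) = \<bar>x - w\<bar> * (sqrt (d * p x) * (1/2))"
        by simp
      ultimately show ?thesis
        by (simp only: nn_integral_cmult_indicator sets_lborel borel_open open_greaterThanLessThan
            ennreal_mult' ennreal_mult'' abs_ge_zero)
    qed
    also have "\<dots> \<le> ennreal \<bar>x - w\<bar> * (\<integral>\<^sup>+s. ennreal (p (w + (x - w) * s)) \<partial>lborel)"
      using ptwise by (intro mult_left_mono nn_integral_mono) (auto simp: indicator_def intro!: ennreal_leI)
    also have "\<dots> = (\<integral>\<^sup>+s. ennreal (p s) \<partial>lborel)"
      using False by (subst nn_integral_real_affine[of "\<lambda>s. ennreal (p s)" "x - w" w]) auto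
    also have "\<dots> = ennreal I"
      unfolding I_def using int log_concave_nonneg[OF lc] by (simp add: nn_integral_eq_integral)
    finally show ?thesis
      by (subst (asm) ennreal_le_iff) (auto simp: I_def log_concave_nonneg[OF lc])
  qed
  have "p x \<le> max d ((4 * I / (v - u))\<^sup>2 / d)" for x
  proof (cases "d \<le> p x")
    case True
    define w where "w = (if (v - u) / 2 \<le> \<bar>x - u\<bar> then u else v)"
    have "v - u \<le> \<bar>x - u\<bar> + \<bar>x - v\<bar>" by linarith
    then have w: "(v - u) / 2 \<le> \<bar>x - w\<bar>" "d \<le> p w"
      using d uv by (auto simp: w_def split: if_splits)
    have "(v - u) / 4 * sqrt (d * p x) \<le> \<bar>x - w\<bar> / 2 * sqrt (d * p x)"
      using w d True by (intro mult_right_mono) auto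
    also have "\<dots> \<le> I" using w True by (intro key)
    finally have "sqrt (d * p x) \<le> 4 * I / (v - u)"
      using uv by (simp add: field_simps)
    then have "d * p x \<le> (4 * I / (v - u))\<^sup>2"
      by (rule sqrt_le_D)
    then have "p x \<le> (4 * I / (v - u))\<^sup>2 / d"
      using d(1) by (simp only: pos_le_divide_eq mult.commute)
    then show ?thesis by simp
  qed simp
  then show ?thesis by (intro bdd_aboveI2)
qed

section \<open>Convolution of log-concave densities\<close>

lemma prob_density_integrable:
  assumes "prob_density p"
  shows "integrable lborel p"
  using assms by (intro integrableI_nonneg) (auto simp: prob_density_def)

lemma log_concave_density_bdd_above: "log_concave_density p \<Longrightarrow> bdd_above (range p)"
  by (simp add: log_concave_density_def log_concave_integrable_bdd_above prob_density_integrable)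

lemma
  assumes p: "log_concave_density p" and q: "log_concave_density q"
  shows integrable_convolution_kernel: "integrable lborel (\<lambda>x. p x * q (z - x))"
    and bdd_above_convolution_kernel: "bdd_above (range (\<lambda>x. p x * q (z - x)))"
proof -
  have nonneg: "0 \<le> p x" "0 \<le> q x" for x
    using p q by (auto simp: log_concave_density_def prob_density_def)
  have [measurable]: "p \<in> borel_measurable borel" "q \<in> borel_measurable borel"
    using p q by (auto simp: log_concave_density_def prob_density_def)
  obtain a b where ab: "\<And>x. p x \<le> a" "\<And>x. q x \<le> b"
    using p[THEN log_concave_density_bdd_above] q[THEN log_concave_density_bdd_above]
    by (auto simp: bdd_above_def)
  have "integrable lborel (\<lambda>x. p x * b)"
    using p by (simp add: log_concave_density_def prob_density_integrable)
  then show "integrable lborel (\<lambda>x. p x * q (z - x))"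
    by (rule Bochner_Integration.integrable_bound)
      (use ab nonneg in \<open>auto simp: abs_mult intro!: mult_left_mono intro: order_trans[OF _ abs_ge_self]\<close>)
  have "0 \<le> a" using nonneg(1) ab(1) by (rule order_trans)
  then show "bdd_above (range (\<lambda>x. p x * q (z - x)))"
    using ab nonneg by (intro bdd_aboveI2[where M="a * b"] mult_mono) auto
qed

lemma (in prob_space) distributed_fun_convolution:
  assumes indep: "indep_var borel X borel Y"
    and p: "log_concave_density p" "distributed M lborel X (\<lambda>x. ennreal (p x))"
    and q: "log_concave_density q" "distributed M lborel Y (\<lambda>x. ennreal (q x))"
  shows "distributed M lborel (\<lambda>\<omega>. X \<omega> + Y \<omega>) (\<lambda>z. ennreal (fun_convolution p q z))"
proof -
  have nonneg: "0 \<le> p x" "0 \<le> q x" for x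
    using p q by (auto simp: log_concave_density_def prob_density_def)
  have [measurable]: "p \<in> borel_measurable borel" "q \<in> borel_measurable borel"
    using p q by (auto simp: log_concave_density_def prob_density_def)
  have "(\<integral>\<^sup>+y. ennreal (p (z - y)) * ennreal (q y) \<partial>lborel) = ennreal (fun_convolution p q z)" for z
  proof -
    have "(\<integral>\<^sup>+y. ennreal (p (z - y)) * ennreal (q y) \<partial>lborel) = (\<integral>\<^sup>+x. ennreal (p x * q (z - x)) \<partial>lborel)"
      by (subst nn_integral_real_affine[of _ "-1" z]) (auto simp: nonneg ennreal_mult)
    also have "\<dots> = ennreal (fun_convolution p q z)"
      unfolding fun_convolution_def
      by (intro nn_integral_eq_integral integrable_convolution_kernel p q) (simp add: nonneg)
    finally show ?thesis .
  qed
  then show ?thesis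
    using distributed_convolution[OF indep p(2) q(2)] by simp
qed

lemma (in prob_space) prob_density_if_distributed:
  assumes f: "distributed M lborel Z (\<lambda>x. ennreal (f x))" and nonneg: "\<And>x. 0 \<le> f x"
  shows "prob_density f"
proof -
  have [measurable]: "(\<lambda>x. ennreal (f x)) \<in> borel_measurable lborel"
    using f by (rule distributed_borel_measurable)
  have "(\<lambda>x. enn2real (ennreal (f x))) \<in> borel_measurable lborel"
    by measurable
  moreover have "(\<integral>\<^sup>+x. ennreal (f x) \<partial>lborel) = emeasure (density lborel (\<lambda>x. ennreal (f x))) UNIV"
    by (simp add: emeasure_density)
  moreover have "\<dots> = 1"
    using prob_space.emeasure_space_1[OF prob_space_distr[OF distributed_measurable[OF f]]]
    by (simp add: distributed_distr_eq_density[OF f])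
  ultimately show ?thesis
    by (simp add: prob_density_def nonneg)
qed

theorem log_concave_fun_convolution:
  assumes "log_concave_density p" "log_concave_density q"
  shows "log_concave (fun_convolution p q)"
  unfolding fun_convolution_def
  using assms
  by (intro log_concave_marginal log_concave2_convolution_kernel integrable_convolution_kernel
      bdd_above_convolution_kernel) (auto simp: log_concave_density_def)

section \<open>Convolution of strongly log-concave densities\<close>

lemma log_concave_normal_density: "log_concave (normal_density 0 s)"
  using log_concave_gaussian[of "1 / sqrt (2 * pi * s\<^sup>2)" "1 / (2 * s\<^sup>2)"]
  by (simp add: normal_density_def[abs_def])

lemma log_concave_density_SLC1:
  assumes "p \<in> SLC1 v"
  shows "log_concave_density p"
proof -
  obtain g where g: "log_concave g" "\<And>x. p x = g x * normal_density 0 (sqrt v) x"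
    using assms by (auto simp: SLC1_def)
  have "log_concave (\<lambda>x. g x * normal_density 0 (sqrt v) x)"
    using g(1) log_concave_normal_density by (rule log_concave_mult)
  then show ?thesis
    using assms by (simp add: log_concave_density_def SLC1_def g(2)[abs_def])
qed

text \<open>This is the factorisation of the joint density of a pair of independent centred normal variables
  with variances \<open>a\<close> and \<open>b\<close> into the density of their sum \<open>z\<close> and the conditional density of the first
  variable \<open>x\<close> given the sum, whose mean is \<open>a / (a + b) * z\<close>.\<close>

lemma normal_density_product:
  fixes a b :: real
  assumes "0 < a" "0 < b"
  shows "normal_density 0 (sqrt a) x * normal_density 0 (sqrt b) (z - x)
    = normal_density 0 (sqrt (a + b)) z * normal_density 0 (sqrt (a * b / (a + b))) (x - a / (a + b) * z)"
proof -
  have "x\<^sup>2 / (2 * a) + (z - x)\<^sup>2 / (2 * b)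
      = z\<^sup>2 / (2 * (a + b)) + (x - a / (a + b) * z)\<^sup>2 / (2 * (a * b / (a + b)))"
  proof -
    have "a + b \<noteq> 0" using assms by simp
    then show ?thesis
      using assms by (simp add: divide_simps) algebra
  qed
  then have e: "exp (- x\<^sup>2 / (2 * a)) * exp (- (z - x)\<^sup>2 / (2 * b))
      = exp (- z\<^sup>2 / (2 * (a + b))) * exp (- (x - a / (a + b) * z)\<^sup>2 / (2 * (a * b / (a + b))))"
    by (simp flip: exp_add)
  have s: "sqrt (2 * pi * a) * sqrt (2 * pi * b) = sqrt (2 * pi * (a + b)) * sqrt (2 * pi * (a * b / (a + b)))"
    using assms by (simp flip: real_sqrt_mult)
  show ?thesis
    using assms e s by (simp add: normal_density_def field_simps)
qed

text \<open>The log-concave factor of the convolution is the marginal of \<open>K\<close>.  The functions \<open>g\<close> and \<open>h\<close> may be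
  unbounded and far from integrable, so integrability and boundedness of the fibres of \<open>K\<close> are read off from
  \<open>K x z = p x * q (z - x) / \<phi> z\<close>.\<close>

theorem SLC1_fun_convolution:
  assumes ab: "0 < a" "0 < b" and p: "p \<in> SLC1 a" and q: "q \<in> SLC1 b"
    and pd: "prob_density (fun_convolution p q)"
  shows "fun_convolution p q \<in> SLC1 (a + b)"
proof -
  obtain g where g: "log_concave g" "\<And>x. p x = g x * normal_density 0 (sqrt a) x"
    using p by (auto simp: SLC1_def)
  obtain h where h: "log_concave h" "\<And>x. q x = h x * normal_density 0 (sqrt b) x"
    using q by (auto simp: SLC1_def)
  let ?\<phi> = "normal_density 0 (sqrt (a + b))"
  let ?\<psi> = "normal_density 0 (sqrt (a * b / (a + b)))"
  define K where "K x z = g x * h (z - x) * ?\<psi> (x - a / (a + b) * z)" for x z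
  have pos: "0 < ?\<phi> z" for z using ab by (simp add: normal_density_pos)
  have pq: "p x * q (z - x) = ?\<phi> z * K x z" for x z
  proof -
    have "p x * q (z - x) = g x * h (z - x) * (normal_density 0 (sqrt a) x * normal_density 0 (sqrt b) (z - x))"
      by (simp add: g(2) h(2))
    then show ?thesis
      unfolding normal_density_product[OF ab] K_def by simp
  qed
  have K: "K x z = 1 / ?\<phi> z * (p x * q (z - x))" for x z
    using pos[of z] by (simp add: pq)
  have "log_concave (\<lambda>z. LINT x|lborel. K x z)"
  proof (rule log_concave_marginal)
    show "log_concave2 K"
      unfolding K_def
      using log_concave2_mult[OF log_concave2_convolution_kernel[OF g(1) h(1)]
          log_concave2_linear[OF log_concave_normal_density, of _ 1 "- (a / (a + b))"]] by simp
    show "integrable lborel (\<lambda>x. K x z)" for z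
      unfolding K using p q
      by (intro integrable_mult_right integrable_convolution_kernel) (auto dest: log_concave_density_SLC1)
    obtain B where "p x * q (z - x) \<le> B z" for x z
      using bdd_above_convolution_kernel[OF p[THEN log_concave_density_SLC1] q[THEN log_concave_density_SLC1]]
      unfolding bdd_above_def by (metis rangeI)
    then show "bdd_above (range (\<lambda>x. K x z))" for z
      unfolding K using pos[of z]
      by (intro bdd_aboveI2[where M="1 / ?\<phi> z * B z"] mult_left_mono) (auto simp: less_imp_le)
  qed
  moreover have "fun_convolution p q z = (LINT x|lborel. K x z) * ?\<phi> z" for z
    unfolding fun_convolution_def pq by simp
  ultimately show ?thesis
    using pd unfolding SLC1_def by blast
qed

theorem theorem6p6:
  fixes M :: "'a measure" and X Y :: "'a \<Rightarrow> real"
  assumes "prob_space M"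
    and "prob_space.indep_var M borel X borel Y"
  shows
    "(\<forall>p q. log_concave_density p \<and> distributed M lborel X (\<lambda>x. ennreal (p x)) \<and>
            log_concave_density q \<and> distributed M lborel Y (\<lambda>x. ennreal (q x)) \<longrightarrow>
            distributed M lborel (\<lambda>\<omega>. X \<omega> + Y \<omega>) (\<lambda>z. ennreal (fun_convolution p q z)) \<and>
            log_concave_density (fun_convolution p q))
     \<and>
     (\<forall>\<sigma> \<tau> :: real. 0 < \<sigma>\<^sup>2 \<and> 0 < \<tau>\<^sup>2 \<and> rv_SLC1 M X (\<sigma>\<^sup>2) \<and> rv_SLC1 M Y (\<tau>\<^sup>2) \<longrightarrow>
            rv_SLC1 M (\<lambda>\<omega>. X \<omega> + Y \<omega>) (\<sigma>\<^sup>2 + \<tau>\<^sup>2))"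
proof -
  interpret prob_space M by fact
  have a: "distributed M lborel (\<lambda>\<omega>. X \<omega> + Y \<omega>) (\<lambda>z. ennreal (fun_convolution p q z))"
      "log_concave_density (fun_convolution p q)"
    if pq: "log_concave_density p" "distributed M lborel X (\<lambda>x. ennreal (p x))"
      "log_concave_density q" "distributed M lborel Y (\<lambda>x. ennreal (q x))" for p q
  proof -
    show d: "distributed M lborel (\<lambda>\<omega>. X \<omega> + Y \<omega>) (\<lambda>z. ennreal (fun_convolution p q z))"
      using assms(2) pq by (rule distributed_fun_convolution)
    have lc: "log_concave (fun_convolution p q)"
      using pq(1,3) by (rule log_concave_fun_convolution)
    then show "log_concave_density (fun_convolution p q)"
      unfolding log_concave_density_def
      using prob_density_if_distributed[OF d log_concave_nonneg[OF lc]] by blast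
  qed
  have "rv_SLC1 M (\<lambda>\<omega>. X \<omega> + Y \<omega>) (v + w)"
    if vw: "0 < v" "0 < w" and X: "rv_SLC1 M X v" and Y: "rv_SLC1 M Y w" for v w
  proof -
    obtain p q where p: "p \<in> SLC1 v" "distributed M lborel X (\<lambda>x. ennreal (p x))"
      and q: "q \<in> SLC1 w" "distributed M lborel Y (\<lambda>x. ennreal (q x))"
      using X Y by (auto simp: rv_SLC1_def)
    note ab = a[OF log_concave_density_SLC1[OF p(1)] p(2) log_concave_density_SLC1[OF q(1)] q(2)]
    then have "fun_convolution p q \<in> SLC1 (v + w)"
      using vw p(1) q(1) by (intro SLC1_fun_convolution) (auto simp: log_concave_density_def)
    with ab(1) show ?thesis unfolding rv_SLC1_def by blast
  qed
  with a show ?thesis by blast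
qed

end
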